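(* Let $G\subseteq GL_n(\mathbb{C})$ be a finite abelian matrix group. Then $$\mathrm{HS}(G) = \bigcup_{k \in \mathcal{K}} \Pi_k,$$ where $\mathcal{K}$ is the set of all positive integers $k$ such that some element $A \in G$ has a primitive $k$th root of unity as an eigenvalue.
   Context: For a set $S \subseteq M_n(\mathbb{C})$, $\mathrm{Co}(S)$ denotes the set of all (finite) convex combinations of elements of $S$, and the hull spectrum $\mathrm{HS}(S)\subseteq\mathbb{C}$ is the set of all complex numbers that occur as eigenvalues of some matrix in $\mathrm{Co}(S)$. $\Pi_k$ denotes the convex hull in $\mathbb{C}$ of the $k$th roots of unity. *)

theory Defs
  imports "HOL-Analysis.Analysis" "HOL-Algebra.Group"
begin

definition GL :: "(complex^'n^'n) monoid" where
  "GL = \<lparr>carrier = {A. invertible A}, mult = (**), one = mat 1\<rparr>"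

lemma group_GL: "group (GL :: (complex^'n^'n) monoid)"
proof (rule groupI)
  fix A :: "complex^'n^'n"
  assume "A \<in> carrier GL"
  then obtain B where "A ** B = mat 1" "B ** A = mat 1"
    by (auto simp: GL_def invertible_def)
  then show "\<exists>B\<in>carrier GL. B \<otimes>\<^bsub>GL\<^esub> A = \<one>\<^bsub>GL\<^esub>"
    by (auto simp: GL_def invertible_def)
qed (auto simp: GL_def invertible_mult matrix_mul_assoc,
     auto simp: invertible_def)

definition eigenvector :: "complex^'n^'n \<Rightarrow> complex^'n \<Rightarrow> complex \<Rightarrow> bool" where
  "eigenvector A v c \<longleftrightarrow> v \<noteq> 0 \<and> A *v v = c *s v"

definition eigenvalue :: "complex^'n^'n \<Rightarrow> complex \<Rightarrow> bool" where
  "eigenvalue A c \<longleftrightarrow> (\<exists>v. eigenvector A v c)"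

text \<open>The convex hull is taken in the real vector space of complex matrices; by
  \<open>convex_hull_explicit\<close> it is the set of all finite convex combinations.\<close>

definition hull_spectrum :: "(complex^'n^'n) set \<Rightarrow> complex set" where
  "hull_spectrum S = {c. \<exists>M \<in> convex hull S. eigenvalue M c}"

definition unity_polygon :: "nat \<Rightarrow> complex set" where
  "unity_polygon k = convex hull {z. z ^ k = 1}"

definition primitive_root_of_unity :: "nat \<Rightarrow> complex \<Rightarrow> bool" where
  "primitive_root_of_unity k z \<longleftrightarrow>
     k > 0 \<and> z ^ k = 1 \<and> (\<forall>j. 0 < j \<and> j < k \<longrightarrow> z ^ j \<noteq> 1)"

end

theory Submission
  imports Defs "HOL-Algebra.Multiplicative_Group"
begin

text \<open>
  Every matrix in the convex hull of \<open>G\<close> commutes with \<open>G\<close>, so each of its eigenspaces is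
  \<open>G\<close>-invariant and contains a common eigenvector \<open>w\<close> of \<open>G\<close>. The eigenvalues of the elements of
  \<open>G\<close> on \<open>w\<close> form a finite multiplicatively closed set of nonzero numbers, hence all \<open>k\<close>-th roots of
  unity for some \<open>k\<close>, and evaluating a convex combination at \<open>w\<close> yields a point of \<open>\<Pi>\<^sub>k\<close>. Conversely,
  an eigenvector of \<open>A\<close> for a primitive \<open>k\<close>-th root of unity turns convex combinations of
  powers of \<open>A\<close> into arbitrary points of \<open>\<Pi>\<^sub>k\<close>.
\<close>

section \<open>Roots of unity\<close>

lemma primitive_root_of_unity_cis:
  assumes "m > 0"
  shows "primitive_root_of_unity m (cis (2 * pi / m))"
proof -
  have "cis (2 * pi / m) ^ j \<noteq> 1" if "0 < j" "j < m" for j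
  proof
    assume "cis (2 * pi / m) ^ j = 1"
    moreover have "cis (2 * pi / m) ^ j = cis (2 * pi * j / m)"
      by (simp add: Complex.DeMoivre mult_ac)
    \<comment> \<open>The value 1 is rewritten as the one at index 0, so that injectivity of
      \<open>j \<mapsto> cis (2 * pi * j / m)\<close> on \<open>{..<m}\<close> applies.\<close>
    ultimately have "cis (2 * pi * j / m) = cis (2 * pi * real 0 / m)"
      by simp
    with bij_betw_imp_inj_on[OF Complex.bij_betw_roots_unity[OF assms]] that show False
      unfolding inj_on_def by fastforce
  qed
  moreover have "cis (2 * pi / m) ^ m = 1"
    using assms by (simp add: Complex.DeMoivre)
  ultimately show ?thesis
    using assms by (simp add: primitive_root_of_unity_def)
qed

text \<open>The powers of \<open>z\<close> with exponent below \<open>k\<close> are \<open>k\<close>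
  distinct solutions of \<open>u ^ k = 1\<close>, and there are exactly \<open>k\<close>
  solutions.\<close>

lemma primitive_root_of_unity_powers:
  assumes "primitive_root_of_unity k z"
  shows "{u. u ^ k = 1} = (\<lambda>j. z ^ j) ` {..<k}"
proof -
  have k: "k > 0" "z ^ k = 1" and prim: "\<And>j. 0 < j \<Longrightarrow> j < k \<Longrightarrow> z ^ j \<noteq> 1"
    using assms by (auto simp: primitive_root_of_unity_def)
  have "z \<noteq> 0" using k by (auto simp: power_0_left)
  have less: "z ^ i \<noteq> z ^ j" if "i < j" "j < k" for i j
  proof
    assume "z ^ i = z ^ j"
    also have "z ^ j = z ^ i * z ^ (j - i)"
      using that by (simp flip: power_add)
    finally show False
      using prim[of "j - i"] that \<open>z \<noteq> 0\<close> by simp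
  qed
  have "inj_on (\<lambda>j. z ^ j) {..<k}"
  proof (rule inj_onI)
    fix i j assume "i \<in> {..<k}" "j \<in> {..<k}" "z ^ i = z ^ j"
    then show "i = j" using less[of i j] less[of j i] by (cases i j rule: linorder_cases) auto
  qed
  then have "card ((\<lambda>j. z ^ j) ` {..<k}) = k" by (simp add: card_image)
  moreover have "(\<lambda>j. z ^ j) ` {..<k} \<subseteq> {u. u ^ k = 1}"
  proof clarify
    fix j show "(z ^ j) ^ k = 1"
      using k by (metis power_mult mult.commute power_one)
  qed
  ultimately show ?thesis
    using card_subset_eq[OF finite_roots_unity] card_roots_unity_eq[OF k(1)] k(1)
    by (metis One_nat_def Suc_leI)
qed

text \<open>Multiplication by \<open>z \<in> H\<close> permutes \<open>H\<close>, so the nonzero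
  product of all elements is unchanged by the factor \<open>z ^ card H\<close>. This gives one
  inclusion; counting roots gives the other.\<close>

lemma finite_mult_closed_eq_roots_of_unity:
  fixes H :: "complex set"
  assumes "finite H" "H \<noteq> {}" "0 \<notin> H" "\<And>a b. a \<in> H \<Longrightarrow> b \<in> H \<Longrightarrow> a * b \<in> H"
  shows "H = {z. z ^ card H = 1}"
proof -
  have pos: "card H > 0" using assms by (simp add: card_gt_0_iff)
  have "z ^ card H = 1" if "z \<in> H" for z
  proof -
    have "z \<noteq> 0" using that assms by auto
    then have inj: "inj_on ((*) z) H" by (simp add: inj_on_def)
    have "(*) z ` H = H"
      using that assms(1,4) inj by (intro endo_inj_surj) auto
    then have "\<Prod>H = (\<Prod>h\<in>H. z * h)"
      using prod.reindex[OF inj, of "\<lambda>x. x"] by simp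
    also have "\<dots> = z ^ card H * \<Prod>H" by (simp add: prod.distrib)
    finally show ?thesis
      using assms(1,3) by (auto simp: prod_zero_iff)
  qed
  then have "H \<subseteq> {z. z ^ card H = 1}" by blast
  moreover have "card {z::complex. z ^ card H = 1} = card H"
    using pos by (rule card_roots_unity_eq)
  ultimately show ?thesis
    using finite_roots_unity[of "card H", where 'a = complex] pos by (intro card_subset_eq) auto
qed

section \<open>Eigenvalues of convex combinations\<close>

lemma matrix_vector_scaleR:
  fixes M :: "complex^'n^'n"
  shows "(r *\<^sub>R M) *v x = of_real r *s (M *v x)"
  by (simp add: vec_eq_iff matrix_vector_mult_def sum_distrib_left scaleR_conv_of_real[where 'a = complex] mult_ac)

lemma matrix_vector_scale:
  fixes M :: "complex^'n^'n"
  shows "M *v (c *s x) = c *s (M *v x)"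
  by (simp add: vector_scalar_commute)

text \<open>For fixed \<open>w\<close> the condition is linear in the pair \<open>(M, d)\<close>
  jointly. Projecting this set to either coordinate gives the next two lemmas.\<close>

lemma convex_eigenvalue_pairs:
  fixes w :: "complex^'n"
  shows "convex {(M, d). M *v w = d *s w}"
  by (auto intro!: convexI simp: matrix_vector_mult_add_rdistrib matrix_vector_scaleR
        vec.scale_left_distrib scaleR_conv_of_real[where 'a = complex])

text \<open>The pairs with \<open>d\<close> in the hull of \<open>T\<close> project onto a convex
  set of matrices that contains \<open>S\<close>, hence its hull.\<close>

lemma convex_hull_eigenvalue:
  fixes w :: "complex^'n"
  assumes "\<And>A. A \<in> S \<Longrightarrow> \<exists>d \<in> T. A *v w = d *s w" and "M \<in> convex hull S"
  shows "\<exists>d \<in> convex hull T. M *v w = d *s w"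
proof -
  let ?P = "{(M, d). M *v w = d *s w} \<inter> (UNIV \<times> (convex hull T))"
  have "convex (fst ` ?P)"
    by (intro convex_linear_image linear_fst convex_Int convex_Times convex_eigenvalue_pairs) auto
  moreover have "S \<subseteq> fst ` ?P"
    using assms(1) hull_subset[of T convex] by force
  ultimately show ?thesis
    using hull_minimal[of S "fst ` ?P" convex] assms(2) by force
qed

text \<open>The mirror image of the previous argument, projecting to the eigenvalue instead of the
  matrix.\<close>

lemma convex_hull_eigenvector:
  fixes w :: "complex^'n"
  assumes "\<And>d. d \<in> T \<Longrightarrow> \<exists>A \<in> S. A *v w = d *s w" and "c \<in> convex hull T"
  shows "\<exists>M \<in> convex hull S. M *v w = c *s w"
proof -
  let ?P = "{(M, d). M *v w = d *s w} \<inter> ((convex hull S) \<times> UNIV)"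
  have "convex (snd ` ?P)"
    by (intro convex_linear_image linear_snd convex_Int convex_Times convex_eigenvalue_pairs) auto
  moreover have "T \<subseteq> snd ` ?P"
    using assms(1) hull_subset[of S convex] by force
  ultimately show ?thesis
    using hull_minimal[of T "snd ` ?P" convex] assms(2) by force
qed

lemma matrix_add_rdistrib:
  fixes A B :: "'a::semiring_1^'m^'n"
  shows "(A + B) ** C = A ** C + B ** C"
  by (simp add: vec_eq_iff matrix_matrix_mult_def distrib_right sum.distrib)

text \<open>The commutant of \<open>B\<close> is a linear subspace, hence convex.\<close>

lemma convex_hull_commute:
  fixes B :: "complex^'n^'n"
  assumes "\<And>A. A \<in> S \<Longrightarrow> A ** B = B ** A" and "M \<in> convex hull S"
  shows "M ** B = B ** M"
proof -
  have "convex {M. M ** B = B ** M}"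
    by (auto intro!: convexI simp: matrix_add_ldistrib matrix_add_rdistrib
        matrix_scalar_ac simp flip: scalar_matrix_assoc)
  then have "convex hull S \<subseteq> {M. M ** B = B ** M}"
    using assms(1) by (intro hull_minimal) auto
  with assms(2) show ?thesis by auto
qed

section \<open>Common eigenvectors of commuting matrices\<close>

text \<open>
  The discrete Fourier components \<open>P i = (\<Sum>j<m. \<omega>\<^sup>-\<^sup>i\<^sup>j A\<^sup>j x)\<close> lie in the \<open>\<omega>\<^sup>i\<close>-eigenspaces of \<open>A\<close> and
  add up to \<open>m x\<close>, so they do not all vanish.
\<close>

lemma eigenvector_in_invariant_subspace:
  fixes A :: "complex^'n^'n"
  assumes W: "vec.subspace W" "\<And>y. y \<in> W \<Longrightarrow> A *v y \<in> W"
    and m: "m > 0" and per: "((*v) A ^^ m) x = x" and x: "x \<in> W" "x \<noteq> 0"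
  shows "\<exists>y \<in> W. \<exists>z. eigenvector A y z"
proof -
  \<comment> \<open>In the notation above, \<open>u\<close> is the inverse of
    \<open>\<omega>\<close>.\<close>
  define u where "u = inverse (cis (2 * pi / m))"
  have prim: "u ^ m = 1" "\<And>j. 0 < j \<Longrightarrow> j < m \<Longrightarrow> u ^ j \<noteq> 1"
    using primitive_root_of_unity_cis[OF m]
    by (auto simp: u_def primitive_root_of_unity_def power_inverse simp del: cis_inverse)
  have "u \<noteq> 0" by (simp add: u_def)
  define f where "f j = ((*v) A ^^ j) x" for j
  have f_Suc: "A *v f j = f (Suc j)" for j by (simp add: f_def)
  have f_W: "f j \<in> W" for j
    by (induction j) (use W x in \<open>auto simp: f_def\<close>)
  define P where "P i = (\<Sum>j<m. (u ^ i) ^ j *s f j)" for i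
  have P_W: "P i \<in> W" for i
    unfolding P_def by (intro vec.subspace_sum vec.subspace_scale W f_W)
  have P_eigen: "A *v P i = inverse (u ^ i) *s P i" for i
  proof -
    define v where "v = u ^ i"
    have v: "v \<noteq> 0" "v ^ m = 1"
      using \<open>u \<noteq> 0\<close> prim(1) by (auto simp: v_def simp flip: power_mult)
        (metis mult.commute power_mult power_one)
    have "A *v P i = (\<Sum>j<m. v ^ j *s f (Suc j))"
      unfolding P_def v_def by (simp add: vec.linear_sum[OF matrix_vector_mul_linear_gen]
          matrix_vector_scale f_Suc)
    also have "\<dots> = inverse v *s (\<Sum>j<m. v ^ Suc j *s f (Suc j))"
      using v by (simp add: vec.scale_sum_right flip: mult.assoc)
    also have "(\<Sum>j<m. v ^ Suc j *s f (Suc j)) = P i"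
    proof -
      \<comment> \<open>The shift trades the term at index 0 for the one at index \<open>m\<close>;
        the two agree by periodicity.\<close>
      have "(\<Sum>j<m. v ^ Suc j *s f (Suc j)) + v ^ 0 *s f 0 = (\<Sum>j<Suc m. v ^ j *s f j)"
        by (simp only: sum.lessThan_Suc_shift add.commute)
      also have "\<dots> = P i + v ^ m *s f m"
        by (simp add: P_def v_def)
      also have "v ^ m *s f m = v ^ 0 *s f 0"
        using per v(2) by (simp add: f_def)
      finally show ?thesis by simp
    qed
    finally show ?thesis by (simp add: v_def)
  qed
  \<comment> \<open>After exchanging the sums, the inner geometric sum vanishes for every
    \<open>j\<close> except 0.\<close>
  have "(\<Sum>i<m. P i) = (\<Sum>j<m. (\<Sum>i<m. (u ^ i) ^ j) *s f j)"
    unfolding P_def by (subst sum.swap) (simp add: vec.scale_sum_left)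
  also have "\<dots> = (\<Sum>j<m. if j = 0 then of_nat m *s x else 0)"
  proof (rule sum.cong[OF refl])
    fix j assume j: "j \<in> {..<m}"
    have "(\<Sum>i<m. (u ^ i) ^ j) = (\<Sum>i<m. (u ^ j) ^ i)"
      by (simp add: mult.commute flip: power_mult)
    also have "\<dots> = (if j = 0 then of_nat m else 0)"
    proof (cases "j = 0")
      case False
      moreover have "(u ^ j) ^ m = 1"
        using prim(1) by (metis mult.commute power_mult power_one)
      ultimately show ?thesis
        using prim(2)[of j] j by (simp add: geometric_sum)
    qed simp
    finally show "(\<Sum>i<m. (u ^ i) ^ j) *s f j = (if j = 0 then of_nat m *s x else 0)"
      by (simp add: f_def)
  qed
  also have "\<dots> = of_nat m *s x" using m by (simp add: sum.delta)
  finally have "(\<Sum>i<m. P i) \<noteq> 0" using m x by simp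
  then obtain i where "P i \<noteq> 0" by (meson sum.neutral)
  with P_W P_eigen show ?thesis unfolding eigenvector_def by blast
qed

text \<open>Induction on \<open>F\<close> with \<open>W\<close> varying: \<open>W\<close> shrinks to
  an eigenspace of the new matrix inside it. This stays invariant under all of \<open>G\<close>
  because \<open>G\<close> commutes.\<close>

lemma common_eigenvector:
  fixes G :: "(complex^'n^'n) set"
  assumes "finite F" "F \<subseteq> G"
    and comm: "\<And>A B. A \<in> G \<Longrightarrow> B \<in> G \<Longrightarrow> A ** B = B ** A"
    and per: "\<And>A. A \<in> G \<Longrightarrow> \<exists>m>0. \<forall>x. ((*v) A ^^ m) x = x"
    and "vec.subspace W" "\<And>A y. A \<in> G \<Longrightarrow> y \<in> W \<Longrightarrow> A *v y \<in> W" "x \<in> W" "x \<noteq> 0"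
  shows "\<exists>y \<in> W. y \<noteq> 0 \<and> (\<forall>A\<in>F. \<exists>z. A *v y = z *s y)"
  using assms(1,2,5-)
proof (induction F arbitrary: W x rule: finite_induct)
  case empty
  then show ?case by blast
next
  case (insert A F)
  have A: "A \<in> G" using insert.prems by auto
  obtain m where m: "m > 0" "\<And>x. ((*v) A ^^ m) x = x" using per[OF A] by blast
  obtain y z where y: "y \<in> W" "eigenvector A y z"
    using eigenvector_in_invariant_subspace[of W A m x] insert.prems A m by metis
  let ?W = "{y \<in> W. A *v y = z *s y}"
  have "vec.subspace ?W"
    using insert.prems(2)
    by (auto simp: vec.subspace_def matrix_vector_right_distrib matrix_vector_scale
        vec.scale_right_distrib mult.commute)
  moreover have "B *v y \<in> ?W" if "B \<in> G" "y \<in> ?W" for B y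
    using that insert.prems(3) comm[OF A that(1)]
    by (auto simp: matrix_vector_mul_assoc) (simp add: matrix_vector_scale flip: matrix_vector_mul_assoc)
  moreover have "y \<in> ?W" "y \<noteq> 0" using y by (auto simp: eigenvector_def)
  ultimately obtain w where "w \<in> ?W" "w \<noteq> 0" "\<forall>B\<in>F. \<exists>z. B *v w = z *s w"
    using insert.IH[of ?W y] insert.prems(1) by blast
  then show ?case by blast
qed

section \<open>The hull spectrum of the group\<close>

lemma GL_simps:
  "A \<otimes>\<^bsub>GL\<^esub> B = A ** B" "\<one>\<^bsub>GL\<^esub> = mat 1"
  by (simp_all add: GL_def)

lemma GL_pow_vector:
  fixes A :: "complex^'n^'n"
  shows "(A [^]\<^bsub>GL\<lparr>carrier := G\<rparr>\<^esub> (j::nat)) *v x = ((*v) A ^^ j) x"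
  by (induction j arbitrary: x)
    (simp_all add: nat_pow_def GL_simps funpow_swap1 flip: matrix_vector_mul_assoc)

theorem corollary3p5:
  fixes G :: "(complex^'n^'n) set"
  assumes "subgroup G GL"
    and "comm_group (GL\<lparr>carrier := G\<rparr>)"
    and "finite G"
  shows "hull_spectrum G =
    (\<Union>k \<in> {k. k > 0 \<and> (\<exists>A\<in>G. \<exists>z. primitive_root_of_unity k z \<and> eigenvalue A z)}.
       unity_polygon k)"
proof (intro equalityI subsetI)
  let ?H = "GL\<lparr>carrier := G\<rparr>"
  interpret comm_group ?H by (rule assms)
  have comm: "A ** B = B ** A" if "A \<in> G" "B \<in> G" for A B
    using m_comm[of A B] that by (simp add: GL_simps)
  have mult: "A ** B \<in> G" if "A \<in> G" "B \<in> G" for A B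
    using m_closed[of A B] that by (simp add: GL_simps)
  have one: "mat 1 \<in> G"
    using one_closed by (simp add: GL_simps)
  have inv: "invertible A" if "A \<in> G" for A
    using subgroup.subset[OF assms(1)] that by (auto simp: GL_def)
  have per: "\<exists>m>0. \<forall>x. ((*v) A ^^ m) x = x" if "A \<in> G" for A
  \<comment> \<open>By Lagrange's theorem the group order is a period for every element.\<close>
  proof (intro exI[of _ "order ?H"] conjI allI)
    show "order ?H > 0" using assms(3) one by (auto simp: order_def card_gt_0_iff)
    fix x show "((*v) A ^^ order ?H) x = x"
      using pow_order_eq_1[of A] that by (simp add: GL_simps flip: GL_pow_vector[where G = G])
  qed
  fix c
  {
    assume "c \<in> hull_spectrum G"
    then obtain M v where M: "M \<in> convex hull G" and v: "v \<noteq> 0" "M *v v = c *s v"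
      by (auto simp: hull_spectrum_def eigenvalue_def eigenvector_def)
    let ?W = "{y. M *v y = c *s y}"
    have "vec.subspace ?W"
      by (auto simp: vec.subspace_def matrix_vector_right_distrib matrix_vector_scale
          vec.scale_right_distrib mult.commute)
    moreover have "A *v y \<in> ?W" if "A \<in> G" "y \<in> ?W" for A y
      using that(2) convex_hull_commute[OF comm M, of A] that(1)
      by (auto simp: matrix_vector_mul_assoc) (simp add: matrix_vector_scale flip: matrix_vector_mul_assoc)
    ultimately obtain w where w: "M *v w = c *s w" "w \<noteq> 0" "\<forall>A\<in>G. \<exists>z. A *v w = z *s w"
      using common_eigenvector[OF assms(3) subset_refl comm per, of ?W v] v by blast
    \<comment> \<open>\<open>\<phi>\<close> is the character by which \<open>G\<close> acts on the
      line spanned by \<open>w\<close>.\<close>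
    then obtain \<phi> where \<phi>: "\<And>A. A \<in> G \<Longrightarrow> A *v w = \<phi> A *s w" by metis
    have \<phi>_mult: "\<phi> (A ** B) = \<phi> A * \<phi> B" if "A \<in> G" "B \<in> G" for A B
    proof -
      have "\<phi> (A ** B) *s w = (\<phi> A * \<phi> B) *s w"
        using \<phi>[OF mult[OF that]] that
        by (simp add: \<phi> matrix_vector_scale mult.commute flip: matrix_vector_mul_assoc) auto
      with w show ?thesis by simp
    qed
    have "\<phi> A \<noteq> 0" if "A \<in> G" for A
    proof
      assume "\<phi> A = 0"
      then have "A *v w = 0" using \<phi>[OF that] by simp
      with inv[OF that] w(2) show False
        by (metis invertible_def matrix_vector_mul_assoc matrix_vector_mul_lid matrix_vector_mult_0_right)
    qed
    then have "0 \<notin> \<phi> ` G" by force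
    moreover have "a * b \<in> \<phi> ` G" if "a \<in> \<phi> ` G" "b \<in> \<phi> ` G" for a b
      using that mult by (auto simp flip: \<phi>_mult)
    ultimately have H: "\<phi> ` G = {z. z ^ card (\<phi> ` G) = 1}"
      using assms(3) one by (intro finite_mult_closed_eq_roots_of_unity) auto
    define k where "k = card (\<phi> ` G)"
    have k: "k > 0" using assms(3) one by (auto simp: k_def card_gt_0_iff)
    have H: "\<phi> ` G = {z. z ^ k = 1}" using H by (simp only: k_def)
    \<comment> \<open>The image of \<open>\<phi>\<close> contains this primitive root, so some
      element of \<open>G\<close> has it as an eigenvalue and \<open>k\<close> is an admissible
      index.\<close>
    have prim: "primitive_root_of_unity k (cis (2 * pi / k))"
      by (rule primitive_root_of_unity_cis[OF k])
    then have "cis (2 * pi / k) \<in> \<phi> ` G"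
      unfolding H by (simp add: primitive_root_of_unity_def)
    then obtain A where "A \<in> G" "eigenvalue A (cis (2 * pi / k))"
      using \<phi> w(2) unfolding eigenvalue_def eigenvector_def by (metis imageE)
    moreover obtain d where "d \<in> convex hull (\<phi> ` G)" "M *v w = d *s w"
      using convex_hull_eigenvalue[OF _ M, of "\<phi> ` G" w] \<phi> by blast
    then have "c \<in> unity_polygon k"
      using w by (simp add: H unity_polygon_def)
    ultimately show "c \<in> (\<Union>k \<in> {k. k > 0 \<and>
        (\<exists>A\<in>G. \<exists>z. primitive_root_of_unity k z \<and> eigenvalue A z)}. unity_polygon k)"
      using k prim by blast
  }
  assume "c \<in> (\<Union>k \<in> {k. k > 0 \<and>
    (\<exists>A\<in>G. \<exists>z. primitive_root_of_unity k z \<and> eigenvalue A z)}. unity_polygon k)"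
  then obtain k A z v where A: "A \<in> G" and z: "primitive_root_of_unity k z"
    and v: "v \<noteq> 0" "A *v v = z *s v" and c: "c \<in> convex hull {u. u ^ k = 1}"
    by (auto simp: unity_polygon_def eigenvalue_def eigenvector_def)
  \<comment> \<open>All powers of \<open>A\<close> share the eigenvector \<open>v\<close>, and their
    eigenvalues on it exhaust the \<open>k\<close>-th roots of unity.\<close>
  have "(A [^]\<^bsub>?H\<^esub> j) *v v = z ^ j *s v" for j :: nat
    unfolding GL_pow_vector
    by (induction j) (simp_all add: v matrix_vector_scale mult.commute)
  moreover have "A [^]\<^bsub>?H\<^esub> j \<in> G" for j :: nat
    using nat_pow_closed[of A j] A by simp
  ultimately have "\<exists>B\<in>G. B *v v = d *s v" if "d \<in> {u. u ^ k = 1}" for d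
    using that unfolding primitive_root_of_unity_powers[OF z] by blast
  then obtain M where "M \<in> convex hull G" "M *v v = c *s v"
    using convex_hull_eigenvector[OF _ c] by blast
  with v show "c \<in> hull_spectrum G"
    by (auto simp: hull_spectrum_def eigenvalue_def eigenvector_def)
qed

end
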